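(* Let $A=\{1,\dots,t\}$ be a finite set, let $k>1$ be an integer, let $\mathcal{C}$ be a clone on $A$ containing a $k$-edge operation, and let $\mathbf{A}=(A,\mathcal{C})$. Let $L$ be the set of lengths $|\mathbf{a}|$ of words $\mathbf{a}\in A^+$ such that, for some $(c,d)\in A^2$, $\mathbf{a}$ is a minimal element of $\lambda(\mathcal{C},(c,d))$ with respect to $\le_{\mathrm{E}}$. Then $L$ is finite, so $m:=\max(L)$ (with $m:=1$ if $L=\emptyset$) is a natural number, and $\mathcal{C}$ equals the set of all finitary operations on $A$ that preserve the relation $\mathcal{C}^{[m]}\subseteq A^{A^m}$ and every subuniverse of $\mathbf{A}^{k-1}$.
   Context: A clone on $A$ is a set of finitary operations on $A$ closed under composition and containing all projections; $\mathcal{C}^{[n]}$ denotes its $n$-ary members, viewed as elements of $A^{A^n}$, so $\mathcal{C}^{[m]}$ is a finitary relation on $A$ indexed by $A^m$. An operation $f:A^r\to A$ preserves a relation $R\subseteq A^I$ ($I$ finite) if $R$ is closed under $f$ applied coordinatewise; in particular $f$ preserves $\mathcal{C}^{[m]}$ iff $x\mapsto f(g_1(x),\dots,g_r(x))$ lies in $\mathcal{C}^{[m]}$ for all $g_1,\dots,g_r\in\mathcal{C}^{[m]}$. A $k$-edge operation ($k\ge2$) is $t:A^{k+1}\to A$ with $t(y,y,x,\dots,x)=t(y,x,y,x,\dots,x)=x$ and $t(x,\dots,x,y,x,\dots,x)=x$ ($y$ in position $i$) for each $i\in\{4,\dots,k+1\}$, for all $x,y$. $A^+=\bigcup_{n\ge1}A^n$,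 $|\mathbf{a}|$ is the length of $\mathbf{a}$. $<_{\mathrm{lex}}$ is the strict lexicographic order on $A^n$ induced by $1<\dots<t$. For $\mathbf{a}\in A^n$, $\varphi(\mathcal{C},\mathbf{a}):=\{(f(\mathbf{a}),g(\mathbf{a})) : f,g\in\mathcal{C}^{[n]},\ f(\mathbf{c})=g(\mathbf{c})\ \forall\mathbf{c}<_{\mathrm{lex}}\mathbf{a}\}$ and $\lambda(\mathcal{C},(c,d)):=\{\mathbf{a}\in A^+ : (c,d)\notin\varphi(\mathcal{C},\mathbf{a})\}$. $\mathrm{firstOcc}(\mathbf{a},b)$ is $0$ if $b$ does not occur in $\mathbf{a}$, otherwise the least $i$ with $a_i=b$; $(a_1,\dots,a_m)\le_{\mathrm{E}}(b_1,\dots,b_n)$ means there is a strictly increasing $h:\{1,\dots,m\}\to\{1,\dots,n\}$ with $a_i=b_{h(i)}$ for all $i$, $\{a_1,\dots,a_m\}=\{b_1,\dots,b_n\}$, and $h(\mathrm{firstOcc}(\mathbf{a},c))=\mathrm{firstOcc}(\mathbf{b},c)$ for all $c\in\{a_1,\dots,a_m\}$. *)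

theory Defs
  imports Main
begin

text \<open>Conventions. The base set is a set A of naturals (in the theorem A = {1..t}).
An n-ary operation is a function on lists: it maps A^n (lists of length n over A)
into A and is undefined outside A^n (extensional representation). A clone is a
family C indexed by the arity n (n \<ge> 1); C n is the set of n-ary members.\<close>

definition tup :: "nat set \<Rightarrow> nat \<Rightarrow> nat list set" where
  "tup A n = {x. length x = n \<and> set x \<subseteq> A}"

definition ops :: "nat set \<Rightarrow> nat \<Rightarrow> (nat list \<Rightarrow> nat) set" where
  "ops A n = {f. (\<forall>x\<in>tup A n. f x \<in> A) \<and> (\<forall>x. x \<notin> tup A n \<longrightarrow> f x = undefined)}"

definition proj :: "nat set \<Rightarrow> nat \<Rightarrow> nat \<Rightarrow> (nat list \<Rightarrow> nat)" where
  "proj A n i = (\<lambda>x. if x \<in> tup A n then x ! i else undefined)"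

definition comp :: "nat set \<Rightarrow> nat \<Rightarrow> (nat list \<Rightarrow> nat) \<Rightarrow> (nat list \<Rightarrow> nat) list \<Rightarrow> (nat list \<Rightarrow> nat)" where
  "comp A n f gs = (\<lambda>x. if x \<in> tup A n then f (map (\<lambda>g. g x) gs) else undefined)"

definition is_clone :: "nat set \<Rightarrow> (nat \<Rightarrow> (nat list \<Rightarrow> nat) set) \<Rightarrow> bool" where
  "is_clone A C \<longleftrightarrow>
     C 0 = {} \<and>
     (\<forall>n\<ge>1. C n \<subseteq> ops A n) \<and>
     (\<forall>n i. 1 \<le> n \<longrightarrow> i < n \<longrightarrow> proj A n i \<in> C n) \<and>
     (\<forall>m n f gs. 1 \<le> m \<longrightarrow> 1 \<le> n \<longrightarrow> f \<in> C m \<longrightarrow> length gs = m \<longrightarrow> set gs \<subseteq> C n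
        \<longrightarrow> comp A n f gs \<in> C n)"

text \<open>k-edge operation (positions 1-based in the paper, 0-based list indices here).\<close>
definition is_edge_op :: "nat set \<Rightarrow> nat \<Rightarrow> (nat list \<Rightarrow> nat) \<Rightarrow> bool" where
  "is_edge_op A k e \<longleftrightarrow> e \<in> ops A (k+1) \<and>
     (\<forall>x\<in>A. \<forall>y\<in>A.
        e ([y, y] @ replicate (k - 1) x) = x \<and>
        e ([y, x, y] @ replicate (k - 2) x) = x \<and>
        (\<forall>i. 4 \<le> i \<longrightarrow> i \<le> k + 1 \<longrightarrow> e ((replicate (k+1) x)[i - 1 := y]) = x))"

text \<open>Finitary relations R \<subseteq> A^I, tuples being functions I \<Rightarrow> A (undefined outside I).
f (of arity r) preserves R if R is closed under f applied coordinatewise.\<close>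
definition preserves :: "(nat list \<Rightarrow> nat) \<Rightarrow> nat \<Rightarrow> 'i set \<Rightarrow> ('i \<Rightarrow> nat) set \<Rightarrow> bool" where
  "preserves f r I R \<longleftrightarrow>
     (\<forall>gs. length gs = r \<longrightarrow> set gs \<subseteq> R \<longrightarrow>
        (\<lambda>i. if i \<in> I then f (map (\<lambda>g. g i) gs) else undefined) \<in> R)"

definition rtuples :: "'i set \<Rightarrow> nat set \<Rightarrow> ('i \<Rightarrow> nat) set" where
  "rtuples I A = {x. (\<forall>i\<in>I. x i \<in> A) \<and> (\<forall>i. i \<notin> I \<longrightarrow> x i = undefined)}"

definition subuniverse_pow :: "nat set \<Rightarrow> (nat \<Rightarrow> (nat list \<Rightarrow> nat) set) \<Rightarrow> nat \<Rightarrow> (nat \<Rightarrow> nat) set \<Rightarrow> bool" where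
  "subuniverse_pow A C p B \<longleftrightarrow> B \<subseteq> rtuples {0..<p} A \<and>
     (\<forall>n\<ge>1. \<forall>f\<in>C n. preserves f n {0..<p} B)"

definition lex_less :: "nat list \<Rightarrow> nat list \<Rightarrow> bool" where
  "lex_less c a \<longleftrightarrow> length c = length a \<and>
     (\<exists>i<length a. take i c = take i a \<and> c ! i < a ! i)"

definition phi :: "nat set \<Rightarrow> (nat \<Rightarrow> (nat list \<Rightarrow> nat) set) \<Rightarrow> nat list \<Rightarrow> (nat \<times> nat) set" where
  "phi A C a = {(f a, g a) | f g. f \<in> C (length a) \<and> g \<in> C (length a) \<and>
      (\<forall>c\<in>tup A (length a). lex_less c a \<longrightarrow> f c = g c)}"

definition lam :: "nat set \<Rightarrow> (nat \<Rightarrow> (nat list \<Rightarrow> nat) set) \<Rightarrow> nat \<times> nat \<Rightarrow> nat list set" where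
  "lam A C cd = {a. a \<noteq> [] \<and> set a \<subseteq> A \<and> cd \<notin> phi A C a}"

text \<open>firstOcc, 1-based as in the paper; 0 if absent.\<close>
definition firstOcc :: "nat list \<Rightarrow> nat \<Rightarrow> nat" where
  "firstOcc a b = (if b \<in> set a then Suc (LEAST i. i < length a \<and> a ! i = b) else 0)"

definition le_E :: "nat list \<Rightarrow> nat list \<Rightarrow> bool" where
  "le_E a b \<longleftrightarrow> (\<exists>h. strict_mono_on {1..length a} h \<and> h ` {1..length a} \<subseteq> {1..length b} \<and>
       (\<forall>i\<in>{1..length a}. a ! (i - 1) = b ! (h i - 1)) \<and>
       set a = set b \<and>
       (\<forall>c\<in>set a. h (firstOcc a c) = firstOcc b c))"

definition minimal_E :: "nat list set \<Rightarrow> nat list \<Rightarrow> bool" where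
  "minimal_E S a \<longleftrightarrow> a \<in> S \<and> (\<forall>b\<in>S. le_E b a \<longrightarrow> b = a)"

end

theory Submission
  imports Defs "HOL-Library.Sublist" "HOL-Library.Infinite_Set"
begin

text \<open>
  Finiteness of \<open>L\<close>: marking in each word the first occurrences of its letters turns \<open>\<le>\<^sub>E\<close> between
  words with the same letters into the plain subsequence order over a larger finite alphabet, so by
  Higman's lemma all antichains are finite.

  Let \<open>D\<close> be the clone of operations preserving \<open>C\<^sup>[\<^sup>m\<^sup>]\<close> and the subuniverses of \<open>A\<^sup>k\<^sup>-\<^sup>1\<close>. Then
  \<open>C \<subseteq> D\<close>, and the two clones agree in all arities up to \<open>m\<close>. As \<open>\<lambda>(C, (c, d))\<close> and
  \<open>\<lambda>(D, (c, d))\<close> are upward closed and the minimal words of the former have length at most \<open>m\<close>,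
  \<open>\<phi>(C, a) = \<phi>(D, a)\<close> for every word \<open>a\<close>. Hence \<open>C\<^sup>[\<^sup>n\<^sup>] \<subseteq> D\<^sup>[\<^sup>n\<^sup>]\<close> are subpowers with the same forks
  and the same projections to any \<open>k - 1\<close> coordinates, which forces equality in the presence of a
  \<open>k\<close>-edge operation.
\<close>

subsection \<open>Higman's lemma and the order on words\<close>

text \<open>Bad sequences in the sense of Nash-Williams: no word embeds as a scattered subword into
  a later one.\<close>

definition bad_seq :: "'a set \<Rightarrow> (nat \<Rightarrow> 'a list) \<Rightarrow> bool" where
  "bad_seq A f \<longleftrightarrow> (\<forall>i. set (f i) \<subseteq> A) \<and> (\<forall>i j. i < j \<longrightarrow> \<not> subseq (f i) (f j))"

text \<open>The entries are fixed one after another, each as short as possible among the bad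
  sequences that share the earlier entries. The resulting limit is bad because badness concerns two
  entries at a time, and any two of them occur together in one of the stages.\<close>

lemma exists_minimal_bad_seq:
  assumes "bad_seq A f"
  obtains g where "bad_seq A g"
    and "\<And>n h. bad_seq A h \<Longrightarrow> (\<And>i. i < n \<Longrightarrow> h i = g i) \<Longrightarrow> length (g n) \<le> length (h n)"
proof -
  \<comment> \<open>\<open>opt n x\<close> depends only on the entries of \<open>x\<close> up to
    index \<open>n\<close>, so later stages, which keep these entries, inherit it.\<close>
  define opt where "opt n x \<longleftrightarrow> (\<forall>h. bad_seq A h \<longrightarrow> (\<forall>i<n. h i = x i) \<longrightarrow> length (x n) \<le> length (h n))"
    for n and x :: "nat \<Rightarrow> 'a list"
  have "\<exists>F. \<forall>n. (bad_seq A (F n) \<and> (\<forall>m<n. opt m (F n))) \<and> (\<forall>i<n. F (Suc n) i = F n i)"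
  proof (rule dependent_nat_choice)
    show "\<exists>x. bad_seq A x \<and> (\<forall>m<0. opt m x)" using assms by auto
  next
    fix x n assume x: "bad_seq A x \<and> (\<forall>m<n. opt m x)"
    obtain y where y: "bad_seq A y" "\<forall>i<n. y i = x i"
      and least: "\<And>h. bad_seq A h \<Longrightarrow> \<forall>i<n. h i = x i \<Longrightarrow> length (y n) \<le> length (h n)"
      using ex_has_least_nat[of "\<lambda>h. bad_seq A h \<and> (\<forall>i<n. h i = x i)" x "\<lambda>h. length (h n)"] x
      by auto
    have "opt m y" if "m < Suc n" for m
    proof (cases "m = n")
      case True
      then show ?thesis unfolding opt_def using y least by simp
    next
      case False
      then have "m < n" using that by simp
      then have "opt m x" using x by blast
      then show ?thesis using y(2) \<open>m < n\<close> unfolding opt_def by simp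
    qed
    then show "\<exists>y. (bad_seq A y \<and> (\<forall>m<Suc n. opt m y)) \<and> (\<forall>i<n. y i = x i)"
      using y by auto
  qed
  then obtain F where F: "\<And>n. bad_seq A (F n)" "\<And>m n. m < n \<Longrightarrow> opt m (F n)"
    "\<And>i n. i < n \<Longrightarrow> F (Suc n) i = F n i" by blast
  \<comment> \<open>Entry \<open>n\<close> is settled at stage \<open>Suc n\<close> and never
    changes afterwards, so the diagonal collects the final entries.\<close>
  define g where "g n = F (Suc n) n" for n
  have stable: "F n i = g i" if "i < n" for i n
    using that by (induction n) (auto simp: g_def less_Suc_eq F(3))
  have "bad_seq A g"
    unfolding bad_seq_def
  proof (intro conjI allI impI)
    show "set (g i) \<subseteq> A" for i using F(1)[of "Suc i"] unfolding g_def bad_seq_def by blast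
    show "\<not> subseq (g i) (g j)" if "i < j" for i j
      using F(1)[of "Suc j"] stable[of i "Suc j"] stable[of j "Suc j"] that
      unfolding bad_seq_def by (metis lessI less_SucI)
  qed
  moreover have "length (g n) \<le> length (h n)" if "bad_seq A h" "\<And>i. i < n \<Longrightarrow> h i = g i" for n h
    using F(2)[of n "Suc n"] that stable[of _ "Suc n"] unfolding opt_def by simp
  ultimately show ?thesis using that by blast
qed

text \<open>Nash-Williams' argument for Higman's lemma: in a minimal bad sequence infinitely many
  words share their first letter, and deleting that letter from them gives a bad sequence that
  contradicts minimality.\<close>

lemma no_bad_seq:
  assumes "finite A"
  shows "\<not> bad_seq A f"
proof
  assume "bad_seq A f"
  then obtain g where g: "bad_seq A g"
    and least: "\<And>n h. bad_seq A h \<Longrightarrow> (\<And>i. i < n \<Longrightarrow> h i = g i) \<Longrightarrow> length (g n) \<le> length (h n)"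
    using exists_minimal_bad_seq by metis
  have ne: "g n \<noteq> []" for n
    using g unfolding bad_seq_def by (metis lessI list_emb_Nil)
  then have "range (\<lambda>n. hd (g n)) \<subseteq> A"
    using g unfolding bad_seq_def by (metis hd_in_set image_subset_iff subsetD)
  then have "finite (range (\<lambda>n. hd (g n)))" using assms finite_subset by blast
  then obtain m where "infinite {n. hd (g n) = hd (g m)}"
    using pigeonhole_infinite[of UNIV "\<lambda>n. hd (g n)"] by auto
  then obtain \<phi> where \<phi>: "strict_mono (\<phi> :: nat \<Rightarrow> nat)" "\<And>n. hd (g (\<phi> n)) = hd (g m)"
    using infinite_enumerate by blast
  \<comment> \<open>The entries before \<open>\<phi> 0\<close> stay; from there on only the words
    with the common head remain, without that head. An embedding between two tails would extend by
    the common letter, and an embedding into a tail is one into the whole word.\<close>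
  define h where "h i = (if i < \<phi> 0 then g i else tl (g (\<phi> (i - \<phi> 0))))" for i
  have "bad_seq A h"
    unfolding bad_seq_def
  proof (intro conjI allI impI notI)
    show "set (h i) \<subseteq> A" for i
    proof -
      have "set (tl (g n)) \<subseteq> set (g n)" for n by (cases "g n") auto
      moreover have "set (g n) \<subseteq> A" for n using g unfolding bad_seq_def by simp
      ultimately show ?thesis unfolding h_def by (auto intro: subset_trans)
    qed
  next
    fix i j :: nat assume ij: "i < j" and sub: "subseq (h i) (h j)"
    have bad: "\<not> subseq (g i) (g j)" if "i < j" for i j
      using g that unfolding bad_seq_def by blast
    consider "j < \<phi> 0" | "i < \<phi> 0" "\<phi> 0 \<le> j" | "\<phi> 0 \<le> i" using ij by linarith
    then show False
    proof cases
      case 1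
      then show ?thesis using bad ij sub by (simp add: h_def)
    next
      case 2
      then have "subseq (g i) (tl (g (\<phi> (j - \<phi> 0))))" using sub by (simp add: h_def)
      then have "subseq (g i) (g (\<phi> (j - \<phi> 0)))"
        by (metis list.collapse list_emb_Cons ne)
      moreover have "i < \<phi> (j - \<phi> 0)"
        using 2 \<phi>(1) by (meson le0 less_le_trans strict_mono_less_eq)
      ultimately show ?thesis using bad by blast
    next
      case 3
      define a b where "a = \<phi> (i - \<phi> 0)" and "b = \<phi> (j - \<phi> 0)"
      have "subseq (tl (g a)) (tl (g b))" using sub 3 ij by (simp add: h_def a_def b_def)
      then have "subseq (hd (g a) # tl (g a)) (hd (g b) # tl (g b))"
        using \<phi>(2) by (simp add: a_def b_def)
      then have "subseq (g a) (g b)" using ne by simp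
      moreover have "a < b"
        using 3 ij \<phi>(1) by (simp add: a_def b_def strict_mono_less)
      ultimately show ?thesis using bad by blast
    qed
  qed
  then have "length (g (\<phi> 0)) \<le> length (h (\<phi> 0))" by (rule least) (simp add: h_def)
  moreover have "h (\<phi> 0) = tl (g (\<phi> 0))" by (simp add: h_def)
  moreover have "length (g (\<phi> 0)) > 0" using ne by simp
  ultimately show False by (metis diff_less length_tl less_one not_le)
qed

lemma subseq_index_map:
  assumes "subseq xs ys"
  obtains h where "strict_mono_on {..<length xs} h"
    and "\<And>i. i < length xs \<Longrightarrow> h i < length ys \<and> ys ! h i = xs ! i"
proof -
  from assms have "\<exists>h. strict_mono_on {..<length xs} h \<and>
      (\<forall>i<length xs. h i < length ys \<and> ys ! h i = xs ! i)"
  proof induction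
    case (list_emb_Nil ys)
    then show ?case by (auto simp: strict_mono_on_def)
  next
    case (list_emb_Cons xs ys y)
    then obtain h where "strict_mono_on {..<length xs} h"
      "\<forall>i<length xs. h i < length ys \<and> ys ! h i = xs ! i" by blast
    then show ?case
      by (intro exI[of _ "\<lambda>i. Suc (h i)"]) (auto simp: strict_mono_on_def)
  next
    case (list_emb_Cons2 x y xs ys)
    then obtain h where "strict_mono_on {..<length xs} h"
      "\<forall>i<length xs. h i < length ys \<and> ys ! h i = xs ! i" by blast
    then show ?case using list_emb_Cons2
      by (intro exI[of _ "\<lambda>i. case i of 0 \<Rightarrow> 0 | Suc i \<Rightarrow> Suc (h i)"])
         (auto simp: strict_mono_on_def split: nat.split)
  qed
  then show ?thesis using that by blast
qed

section \<open>First occurrences and antichains of \<open>le_E\<close>\<close>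

lemma firstOcc_eqI:
  assumes "p < length a" "a ! p = c" "c \<notin> set (take p a)"
  shows "firstOcc a c = Suc p"
proof -
  have "(LEAST i. i < length a \<and> a ! i = c) = p"
  proof (rule Least_equality)
    show "p \<le> i" if "i < length a \<and> a ! i = c" for i
      using that assms by (metis in_set_conv_nth length_take linorder_le_less_linear min_less_iff_conj nth_take)
  qed (use assms in auto)
  moreover have "c \<in> set a" using assms(1,2) nth_mem by blast
  ultimately show ?thesis by (simp add: firstOcc_def)
qed

lemma firstOcc_cases:
  assumes "c \<in> set a"
  obtains p where "p < length a" "a ! p = c" "c \<notin> set (take p a)" "firstOcc a c = Suc p"
proof -
  obtain ys zs where "a = ys @ c # zs" "c \<notin> set ys" using split_list_first[OF assms] by blast
  then show ?thesis using that[of "length ys"] firstOcc_eqI[of "length ys" a c] by simp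
qed

text \<open>The flag turns the condition on first occurrences in \<open>le_E\<close> into equality
  of letters, over an alphabet that is still finite.\<close>

definition mark_first :: "'a list \<Rightarrow> ('a \<times> bool) list" where
  "mark_first a = map (\<lambda>i. (a ! i, a ! i \<notin> set (take i a))) [0..<length a]"

text \<open>Flags are matched along the embedding, so the unique flagged position of a letter goes
  to the unique flagged position of the same letter. Equality of the letter sets is assumed because
  an embedding yields only one inclusion.\<close>

lemma le_E_if_subseq_mark_first:
  assumes sub: "subseq (mark_first a) (mark_first b)" and "set a = set b"
  shows "le_E a b"
proof -
  obtain h where h: "strict_mono_on {..<length a} h"
    "\<And>i. i < length a \<Longrightarrow> h i < length b \<and> mark_first b ! h i = mark_first a ! i"
    using subseq_index_map[OF sub] by (auto simp: mark_first_def)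
  have nth: "b ! h i = a ! i" "a ! i \<notin> set (take (h i) b) \<longleftrightarrow> a ! i \<notin> set (take i a)"
    if "i < length a" for i
    using h(2)[OF that] that by (auto simp: mark_first_def)
  show ?thesis
    unfolding le_E_def
  \<comment> \<open>The shift translates the 0-based list indices of \<open>h\<close> into the
    1-based positions of \<open>le_E\<close>.\<close>
  proof (intro exI[of _ "\<lambda>i. Suc (h (i - 1))"] conjI ballI)
    show "strict_mono_on {1..length a} (\<lambda>i. Suc (h (i - 1)))"
    proof (rule strict_mono_onI)
      fix r s assume "r \<in> {1..length a}" "s \<in> {1..length a}" "r < s"
      then show "Suc (h (r - 1)) < Suc (h (s - 1))"
        using strict_mono_onD[OF h(1), of "r - 1" "s - 1"] by auto
    qed
    show "(\<lambda>i. Suc (h (i - 1))) ` {1..length a} \<subseteq> {1..length b}"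
      using h(2) by (force simp: Suc_le_eq)
    show "a ! (i - 1) = b ! (Suc (h (i - 1)) - 1)" if "i \<in> {1..length a}" for i
      using that nth[of "i - 1"] by auto
    show "Suc (h (firstOcc a c - 1)) = firstOcc b c" if c: "c \<in> set a" for c
    proof -
      obtain p where p: "p < length a" "a ! p = c" "c \<notin> set (take p a)" "firstOcc a c = Suc p"
        using firstOcc_cases[OF c] .
      then have "firstOcc b c = Suc (h p)"
        using h(2)[of p] nth[of p] by (intro firstOcc_eqI) auto
      then show ?thesis using p by simp
    qed
  qed (fact assms)
qed

lemma finite_le_E_antichain:
  assumes "finite A" and words: "\<And>a. a \<in> M \<Longrightarrow> set a \<subseteq> A"
    and anti: "\<And>a b. a \<in> M \<Longrightarrow> b \<in> M \<Longrightarrow> le_E a b \<Longrightarrow> a = b"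
  shows "finite M"
proof (rule ccontr)
  assume inf: "infinite M"
  have "set ` M \<subseteq> Pow A" using words by blast
  then have "finite (set ` M)" using assms(1) finite_subset by auto
  \<comment> \<open>Infinitely many words have the same set of letters; among these, comparability
    in \<open>le_E\<close> reduces to embedding of marked words.\<close>
  then obtain a0 where "infinite {a \<in> M. set a = set a0}"
    using pigeonhole_infinite[OF inf] by blast
  then obtain f :: "nat \<Rightarrow> nat list" where f: "inj f" "range f \<subseteq> {a \<in> M. set a = set a0}"
    using infinite_countable_subset by blast
  have "\<not> bad_seq (A \<times> UNIV) (\<lambda>i. mark_first (f i))"
    using assms(1) by (intro no_bad_seq) auto
  moreover have "set (mark_first (f i)) \<subseteq> A \<times> UNIV" for i
    using f(2) words[of "f i"] nth_mem by (fastforce simp: mark_first_def)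
  ultimately obtain i j where ij: "i < j" "subseq (mark_first (f i)) (mark_first (f j))"
    unfolding bad_seq_def by blast
  moreover have "set (f i) = set (f j)" using f(2) by blast
  ultimately have "le_E (f i) (f j)" using le_E_if_subseq_mark_first by blast
  then have "f i = f j" using f(2) anti by blast
  then show False using f(1) ij(1) by (simp add: inj_eq)
qed

text \<open>A strictly increasing map grows by at least one per step, so between words of equal
  length it is the identity. This makes induction on the length available along
  \<open>le_E\<close>.\<close>

lemma le_E_length:
  assumes "le_E a b"
  shows "length a < length b \<or> a = b"
proof (rule disjCI)
  assume ne: "a \<noteq> b"
  obtain h where h: "strict_mono_on {1..length a} h" "h ` {1..length a} \<subseteq> {1..length b}"
    "\<And>i. i \<in> {1..length a} \<Longrightarrow> a ! (i - 1) = b ! (h i - 1)"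
    using assms unfolding le_E_def by blast
  have "inj_on h {1..length a}" using h(1) by (rule strict_mono_on_imp_inj_on)
  then have le: "length a \<le> length b"
    using card_inj_on_le[OF _ h(2)] by simp
  have gap: "h i + d \<le> h (i + d)" if "1 \<le> i" "i + d \<le> length a" for i d
    using that
  proof (induction d)
    case (Suc d)
    then have "h (i + d) < h (i + Suc d)" using h(1) by (auto simp: strict_mono_on_def)
    then show ?case using Suc by simp
  qed simp
  have "length a \<noteq> length b"
  proof
    assume eq: "length a = length b"
    have "a ! j = b ! j" if "j < length a" for j
    proof -
      have "h i \<in> {1..length a}" if "i \<in> {1..length a}" for i using h(2) that eq by (metis image_subset_iff)
      from this[of 1] this[of "length a"] have "h 1 \<ge> 1" "h (length a) \<le> length a"
        using that by simp_all
      moreover have "Suc j + (length a - Suc j) = length a" using that by simp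
      ultimately have "h (Suc j) = Suc j"
        using gap[of 1 j] gap[of "Suc j" "length a - Suc j"] that by simp
      then show ?thesis using h(3)[of "Suc j"] that by simp
    qed
    then show False using ne eq by (simp add: list_eq_iff_nth_eq)
  qed
  then show "length a < length b" using le by simp
qed

subsection \<open>Upward closedness\<close>

text \<open>\<open>\<tau>\<close> is the witness of \<open>le_E\<close> with 0-based indices, and
  \<open>\<sigma>\<close> is a left inverse that identifies variables without changing letters. The
  last property says that whatever precedes \<open>\<tau> i\<close> in \<open>b\<close> is sent
  strictly before \<open>i\<close>; it makes the substitution compatible with the lexicographic
  order.\<close>

lemma le_E_substitution:
  assumes "le_E a b"
  obtains \<sigma> \<tau> where "\<And>j. j < length b \<Longrightarrow> \<sigma> j < length a \<and> a ! \<sigma> j = b ! j"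
    and "\<And>i. i < length a \<Longrightarrow> \<tau> i < length b \<and> \<sigma> (\<tau> i) = i \<and> (\<forall>j<\<tau> i. \<sigma> j < i)"
proof -
  obtain h where h: "strict_mono_on {1..length a} h" "h ` {1..length a} \<subseteq> {1..length b}"
    "\<And>i. i \<in> {1..length a} \<Longrightarrow> a ! (i - 1) = b ! (h i - 1)"
    and set_eq: "set a = set b" and first: "\<And>c. c \<in> set a \<Longrightarrow> h (firstOcc a c) = firstOcc b c"
    using assms unfolding le_E_def by blast
  define \<tau> where "\<tau> i = h (Suc i) - 1" for i
  have hS: "h (Suc i) = Suc (\<tau> i)" "\<tau> i < length b" "a ! i = b ! \<tau> i" if "i < length a" for i
  proof -
    have "Suc i \<in> {1..length a}" using that by simp
    then have "h (Suc i) \<in> {1..length b}" using h(2) by blast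
    then show "h (Suc i) = Suc (\<tau> i)" "\<tau> i < length b" by (auto simp: \<tau>_def)
    show "a ! i = b ! \<tau> i" using h(3)[of "Suc i"] that by (simp add: \<tau>_def)
  qed
  have less: "i < i'" if "\<tau> i < \<tau> i'" "i < length a" "i' < length a" for i i'
  proof (rule ccontr)
    assume "\<not> i < i'"
    then consider "i = i'" | "i' < i" by linarith
    then show False
    proof cases
      case 2
      then have "h (Suc i') < h (Suc i)" using h(1) that by (auto simp: strict_mono_on_def)
      then show False using hS that by simp
    qed (use that in simp)
  qed
  have inj: "i = i'" if "\<tau> i = \<tau> i'" "i < length a" "i' < length a" for i i'
    using inj_onD[OF strict_mono_on_imp_inj_on[OF h(1)], of "Suc i" "Suc i'"]
      hS(1)[OF that(2)] hS(1)[OF that(3)] that by auto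
  \<comment> \<open>Positions hit by \<open>\<tau>\<close> go to their preimage, all others to the
    first occurrence of their letter in \<open>a\<close>.\<close>
  define \<sigma> where "\<sigma> j = (if \<exists>i<length a. \<tau> i = j then THE i. i < length a \<and> \<tau> i = j
    else firstOcc a (b ! j) - 1)" for j
  have \<sigma>\<tau>: "\<sigma> (\<tau> i) = i" if "i < length a" for i
  proof -
    have "(THE i'. i' < length a \<and> \<tau> i' = \<tau> i) = i" using that inj by blast
    then show ?thesis using that by (auto simp: \<sigma>_def)
  qed
  \<comment> \<open>The inequality \<open>\<tau> (\<sigma> j) \<le> j\<close> uses the condition on
    first occurrences: off the range of \<open>\<tau>\<close>, \<open>\<tau> (\<sigma> j)\<close> is
    the first occurrence of \<open>b ! j\<close> in \<open>b\<close>. Monotonicity then gives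
    \<open>\<sigma> j < i\<close> whenever \<open>j < \<tau> i\<close>.\<close>
  have main: "\<sigma> j < length a \<and> a ! \<sigma> j = b ! j \<and> (\<tau> (\<sigma> j) \<le> j)" if j: "j < length b" for j
  proof (cases "\<exists>i<length a. \<tau> i = j")
    case True
    then show ?thesis using \<sigma>\<tau> hS by auto
  next
    case False
    have "b ! j \<in> set a" using j set_eq by simp
    then obtain p where p: "p < length a" "a ! p = b ! j" "firstOcc a (b ! j) = Suc p"
      using firstOcc_cases by metis
    obtain q where q: "q < length b" "b ! q = b ! j" "b ! j \<notin> set (take q b)"
      "firstOcc b (b ! j) = Suc q"
      using firstOcc_cases[of "b ! j" b] j by auto
    have "\<tau> p = q" using first[OF \<open>b ! j \<in> set a\<close>] p(3) q(4) by (simp add: \<tau>_def)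
    moreover have "q \<le> j"
      using q(1,3) j by (metis in_set_conv_nth length_take linorder_le_less_linear min_less_iff_conj nth_take)
    moreover have "\<sigma> j = firstOcc a (b ! j) - 1" unfolding \<sigma>_def by (rule if_not_P[OF False])
    then have "\<sigma> j = p" using p(3) by simp
    ultimately show ?thesis using p by simp
  qed
  show ?thesis
  proof (rule that[of \<sigma> \<tau>])
    show "\<sigma> j < length a \<and> a ! \<sigma> j = b ! j" if "j < length b" for j using main that by blast
    show "\<tau> i < length b \<and> \<sigma> (\<tau> i) = i \<and> (\<forall>j<\<tau> i. \<sigma> j < i)" if i: "i < length a" for i
    proof (intro conjI allI impI)
      fix j assume "j < \<tau> i"
      then have "j < length b" using hS(2)[OF i] by simp
      then show "\<sigma> j < i" using main[of j] less[of "\<sigma> j" i] i \<open>j < \<tau> i\<close> by auto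
    qed (use i hS \<sigma>\<tau> in auto)
  qed
qed

lemma clone_substitution:
  assumes C: "is_clone A C" and "f \<in> C n" and "1 \<le> m" and \<sigma>: "\<And>j. j < n \<Longrightarrow> \<sigma> j < m"
  obtains g where "g \<in> C m" and "\<And>x. x \<in> tup A m \<Longrightarrow> g x = f (map (\<lambda>j. x ! \<sigma> j) [0..<n])"
proof
  let ?gs = "map (\<lambda>j. proj A m (\<sigma> j)) [0..<n]"
  have "1 \<le> n" using C assms(2) unfolding is_clone_def by (cases n) auto
  moreover have "set ?gs \<subseteq> C m" using C \<sigma> \<open>1 \<le> m\<close> unfolding is_clone_def by auto
  ultimately show "comp A m f ?gs \<in> C m"
    using C assms(2,3) unfolding is_clone_def by auto
  show "comp A m f ?gs x = f (map (\<lambda>j. x ! \<sigma> j) [0..<n])" if "x \<in> tup A m" for x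
    using that by (auto simp: comp_def proj_def o_def)
qed

text \<open>Substituting variables along \<open>\<sigma>\<close> turns witnesses at \<open>b\<close>
  into witnesses at \<open>a\<close>: if \<open>x\<close> first drops below \<open>a\<close> at
  position \<open>i\<close>, the substituted tuple first drops below \<open>b\<close> at
  \<open>\<tau> i\<close>. Hence \<open>lam A C cd\<close> is upward closed under
  \<open>le_E\<close>.\<close>

lemma phi_antimono:
  assumes C: "is_clone A C" and le: "le_E a b" and "a \<noteq> []" and "set a \<subseteq> A"
    and "cd \<in> phi A C b"
  shows "cd \<in> phi A C a"
proof -
  obtain f g where cd: "cd = (f b, g b)" and f: "f \<in> C (length b)" and g: "g \<in> C (length b)"
    and eq: "\<And>c. c \<in> tup A (length b) \<Longrightarrow> lex_less c b \<Longrightarrow> f c = g c"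
    using assms(5) unfolding phi_def by blast
  obtain \<sigma> \<tau> where \<sigma>: "\<And>j. j < length b \<Longrightarrow> \<sigma> j < length a \<and> a ! \<sigma> j = b ! j"
    and \<tau>: "\<And>i. i < length a \<Longrightarrow> \<tau> i < length b \<and> \<sigma> (\<tau> i) = i \<and> (\<forall>j<\<tau> i. \<sigma> j < i)"
    using le_E_substitution[OF le] by metis
  have m: "1 \<le> length a" using \<open>a \<noteq> []\<close> by (cases a) auto
  let ?T = "\<lambda>x. map (\<lambda>j. x ! \<sigma> j) [0..<length b]"
  obtain f' where f': "f' \<in> C (length a)" "\<And>x. x \<in> tup A (length a) \<Longrightarrow> f' x = f (?T x)"
    using clone_substitution[OF C f m] \<sigma> by metis
  obtain g' where g': "g' \<in> C (length a)" "\<And>x. x \<in> tup A (length a) \<Longrightarrow> g' x = g (?T x)"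
    using clone_substitution[OF C g m] \<sigma> by metis
  have Ta: "?T a = b" using \<sigma> by (auto intro: nth_equalityI)
  have "a \<in> tup A (length a)" using assms(4) by (simp add: tup_def)
  then have "cd = (f' a, g' a)" using cd f'(2) g'(2) Ta by simp
  moreover have "f' x = g' x" if x: "x \<in> tup A (length a)" and lx: "lex_less x a" for x
  proof -
    obtain i where i: "i < length a" "take i x = take i a" "x ! i < a ! i"
      using lx unfolding lex_less_def by blast
    have len: "length x = length a" "set x \<subseteq> A" using x by (auto simp: tup_def)
    have "?T x \<in> tup A (length b)" using len \<sigma> by (force simp: tup_def)
    moreover have "lex_less (?T x) b"
      unfolding lex_less_def
    proof (intro conjI exI[of _ "\<tau> i"])
      show "take (\<tau> i) (?T x) = take (\<tau> i) b"
      proof (rule nth_equalityI)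
        fix j assume "j < length (take (\<tau> i) (?T x))"
        then have j: "j < \<tau> i" "j < length b" using \<tau>[OF i(1)] by auto
        then have "\<sigma> j < i" using \<tau>[OF i(1)] by blast
        then have "x ! \<sigma> j = a ! \<sigma> j" using i(2) by (metis nth_take)
        then show "take (\<tau> i) (?T x) ! j = take (\<tau> i) b ! j" using j \<sigma> by simp
      qed simp
      show "?T x ! \<tau> i < b ! \<tau> i" using \<tau>[OF i(1)] i(3) \<sigma>[of "\<tau> i"] by simp
    qed (use \<tau>[OF i(1)] in auto)
    ultimately show ?thesis using eq f'(2) g'(2) x by simp
  qed
  ultimately show ?thesis using f'(1) g'(1) unfolding phi_def by blast
qed

subsection \<open>Subpowers with an edge operation\<close>

lemma funpow_eventually_periodic:
  assumes "finite A" and "\<And>y. y \<in> A \<Longrightarrow> D y \<in> A" and "y \<in> A"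
  obtains M n where "n \<ge> 1" "(D ^^ n) ((D ^^ M) y) = (D ^^ M) y"
proof -
  have mem: "(D ^^ l) y \<in> A" for l using assms by (induction l) auto
  have "\<not> inj (\<lambda>l. (D ^^ l) y)"
  proof
    assume "inj (\<lambda>l. (D ^^ l) y)"
    then have "infinite (range (\<lambda>l. (D ^^ l) y))" by (simp add: finite_image_iff)
    then show False using mem assms(1) by (meson finite_subset image_subsetI)
  qed
  then obtain i j where ij: "i \<noteq> j" "(D ^^ i) y = (D ^^ j) y" by (auto simp: inj_on_def)
  have "\<exists>M n. n \<ge> 1 \<and> (D ^^ n) ((D ^^ M) y) = (D ^^ M) y" if "i < j" "(D ^^ i) y = (D ^^ j) y" for i j
    using that funpow_add[of "j - i" i D]
    by (intro exI[of _ i] exI[of _ "j - i"]) (auto simp: o_def)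
  then show ?thesis using ij that by (metis linorder_neqE_nat)
qed

text \<open>From the fourth argument on, an edge operation ignores a single deviating entry, like a
  near-unanimity operation. With indices from 0 these arguments are \<open>3\<close> to
  \<open>k\<close>.\<close>

lemma edge_op_NU_position:
  assumes e: "is_edge_op A k e" and "length xs = k + 1" and j: "3 \<le> j" "j \<le> k"
    and "x \<in> A" and "xs ! j \<in> A" and "\<And>l. l \<le> k \<Longrightarrow> l \<noteq> j \<Longrightarrow> xs ! l = x"
  shows "e xs = x"
proof -
  have "xs = (replicate (k + 1) x)[Suc j - 1 := xs ! j]"
    using assms(2,7) j(2) by (intro nth_equalityI) (auto simp: nth_list_update simp del: replicate_Suc)
  moreover have "e ((replicate (k + 1) x)[Suc j - 1 := xs ! j]) = x"
    using e assms(5,6) j unfolding is_edge_op_def by (metis Suc_eq_plus1 Suc_le_mono eval_nat_numeral(2) semiring_norm(26,27))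
  ultimately show ?thesis by simp
qed

text \<open>One step of extending agreement with \<open>s\<close> from \<open>P\<close> to \<open>P \<union> {i}\<close>. With \<open>x = s i\<close> and
  \<open>D y = e [x, y, x, \<dots>, x]\<close>, the value \<open>r i\<close> is replaced by a \<open>D\<close>-periodic value; periodicity
  makes it possible to move a fork with these values onto an arbitrary \<open>z \<in> R\<close> with \<open>z i = x\<close>.\<close>
lemma edge_extend_agreement:
  fixes I P T :: "'i set"
  assumes k: "k > 1" and e: "is_edge_op A k e" and finA: "finite A"
    and RS: "R \<subseteq> S" and SA: "S \<subseteq> rtuples I A"
    and closR: "preserves e (k + 1) I R" and closS: "preserves e (k + 1) I S"
    and projs: "\<And>T s. T \<subseteq> I \<Longrightarrow> finite T \<Longrightarrow> card T \<le> k - 1 \<Longrightarrow> s \<in> S \<Longrightarrow> \<exists>r\<in>R. \<forall>j\<in>T. r j = s j"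
    and P: "P \<subseteq> I" "i \<in> I"
    and forks: "\<And>f g. f \<in> S \<Longrightarrow> g \<in> S \<Longrightarrow> \<forall>j\<in>P. f j = g j \<Longrightarrow>
      \<exists>f'\<in>R. \<exists>g'\<in>R. (\<forall>j\<in>P. f' j = g' j) \<and> f' i = f i \<and> g' i = g i"
    and s: "s \<in> S" and r: "r \<in> R" "\<And>j. j \<in> P \<Longrightarrow> r j = s j"
    and T: "finite T" "T \<subseteq> P"
  shows "\<exists>q\<in>R. \<forall>j\<in>insert i T. q j = s j"
  using T
\<comment> \<open>If \<open>T\<close> and \<open>i\<close> together have at most
  \<open>k - 1\<close> points, \<open>projs\<close> suffices. Otherwise the induction hypothesis
  supplies, for each \<open>p\<close> in \<open>T\<close>, an element of \<open>R\<close> that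
  agrees with \<open>s\<close> at \<open>i\<close> and on \<open>T\<close> without
  \<open>p\<close>.\<close>
proof (induction "card T" arbitrary: T)
  case 0
  then have "T = {}" by simp
  then show ?case using projs[of "{i}" s] P(2) s k by auto
next
  case (Suc n T)
  have E1: "e (y # y # replicate (k - 1) x) = x" if "x \<in> A" "y \<in> A" for x y
    using e that unfolding is_edge_op_def by simp
  have E2: "e (y # x # y # replicate (k - 2) x) = x" if "x \<in> A" "y \<in> A" for x y
    using e that unfolding is_edge_op_def by simp
  have app: "\<exists>q\<in>Q. \<forall>j\<in>I. q j = e (map (\<lambda>g. g j) gs)"
    if "Q = R \<or> Q = S" "length gs = k + 1" "set gs \<subseteq> Q" for Q gs
  proof -
    have "(\<lambda>j. if j \<in> I then e (map (\<lambda>g. g j) gs) else undefined) \<in> Q"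
      using that closR closS unfolding preserves_def by blast
    then show ?thesis by (intro bexI) auto
  qed
  have val: "f j \<in> A" if "f \<in> S" "j \<in> I" for f j
    using that SA by (auto simp: rtuples_def)
  have valP: "f j \<in> A" "j \<in> I" if "f \<in> R" "j \<in> P" for f j
    using that RS P(1) val by blast+
  have TI: "T \<subseteq> I" using Suc.prems P by blast
  define x where "x = s i"
  have x: "x \<in> A" using val s P by (simp add: x_def)
  define D where "D y = e (x # y # replicate (k - 1) x)" for y
  have DA: "D y \<in> A" if "y \<in> A" for y
    using e x that k unfolding is_edge_op_def ops_def D_def by (auto simp: tup_def)
  show ?case
  proof (cases "Suc (card T) \<le> k - 1")
    case True
    then show ?thesis using projs[of "insert i T" s] TI P(2) s Suc.prems(1) card_insert_le_m1
      by (metis One_nat_def card_insert_if finite_insert insert_subset le_SucI Suc_leD)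
  next
    case False
    then have "k - 1 \<le> card T" by simp
    \<comment> \<open>The \<open>k - 1\<close> chosen points give elements \<open>zs\<close> for the
      last \<open>k - 1\<close> arguments of \<open>e\<close>; \<open>zs ! l\<close> can deviate
      from \<open>s\<close> on \<open>insert i T\<close> only at \<open>ts ! l\<close>, so at most
      one of them is wrong at any coordinate.\<close>
    then obtain T' where T': "T' \<subseteq> T" "card T' = k - 1" "finite T'"
      using obtain_subset_with_card_n by metis
    then obtain ts where ts: "set ts = T'" "distinct ts" using finite_distinct_list by blast
    then have lts: "length ts = k - 1" using T'(2) distinct_card by metis
    have "\<exists>q\<in>R. \<forall>j\<in>insert i (T - {p}). q j = s j" if "p \<in> T" for p
    proof (rule Suc.hyps(1))
      show "n = card (T - {p})" using Suc.hyps(2) that by simp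
    qed (use Suc.prems in auto)
    then obtain zf where zf: "\<And>p. p \<in> T \<Longrightarrow> zf p \<in> R"
      "\<And>p j. p \<in> T \<Longrightarrow> j \<in> insert i (T - {p}) \<Longrightarrow> zf p j = s j" by metis
    define zs where "zs = map zf ts"
    have lzs: "length zs = k - 1" and zsR: "set zs \<subseteq> R"
      using lts ts(1) T'(1) zf(1) by (auto simp: zs_def)
    have zs_i: "map (\<lambda>g. g i) zs = replicate (k - 1) x"
      using zf(2) ts(1) T'(1) lts by (auto simp: zs_def x_def map_replicate_const intro!: nth_equalityI)
         (metis nth_mem subsetD)
    have zs_out: "(zs ! l) p = s p" if "l < k - 1" "p \<in> T" "ts ! l \<noteq> p" for l p
    proof -
      have "ts ! l \<in> T" using that(1) lts ts(1) T'(1) nth_mem[of l ts] by auto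
      then show ?thesis using that zf(2)[of "ts ! l" p] lts by (simp add: zs_def)
    qed
    have zs0: "zs ! 0 \<in> R" using zsR lzs k by (cases zs) simp_all

    \<comment> \<open>Here \<open>e\<close> is applied to
      \<open>zs ! 0, u, zs ! 0, zs ! 1, ...\<close>. At \<open>i\<close> this computes
      \<open>D (u i)\<close>. On \<open>T\<close>, an error of \<open>zs ! 0\<close> occurs in the
      first and third arguments and is removed by \<open>E2\<close>; an error of another
      \<open>zs ! l\<close> is a single deviation at index \<open>l + 2\<close>.\<close>
    have u_step: "\<exists>u'\<in>R. (\<forall>j\<in>T. u' j = s j) \<and> u' i = D (u i)"
      if u: "u \<in> R" "\<forall>j\<in>T. u j = s j" for u
    proof -
      obtain q where q: "q \<in> R" "\<And>j. j \<in> I \<Longrightarrow> q j = e (map (\<lambda>g. g j) ([zs ! 0, u] @ zs))"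
        using app[of R "[zs ! 0, u] @ zs"] lzs zsR zs0 u(1) k by auto
      have "zs ! 0 \<in> set zs" using lzs k by simp
      then have "(zs ! 0) i = x" using zs_i by (metis in_set_conv_nth nth_map nth_replicate lzs)
      then have "q i = D (u i)" using q(2)[OF P(2)] zs_i by (simp add: D_def)
      moreover have "q p = s p" if p: "p \<in> T" for p
      proof -
        have pI: "p \<in> I" and sp: "s p \<in> A" using p TI val s by auto
        have up: "u p = s p" using u p by blast
        have zp: "(zs ! l) p \<in> A" if "l < k - 1" for l
          using that zsR lzs RS val pI by (metis nth_mem subsetD)
        define L where "L = map (\<lambda>g. g p) ([zs ! 0, u] @ zs)"
        have lL: "length L = k + 1" using lzs k by (simp add: L_def)
        have Lnth: "L ! l = (if l = 0 then (zs ! 0) p else if l = 1 then s p else (zs ! (l - 2)) p)"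
          if "l \<le> k" for l
          using that lzs up k by (auto simp: L_def nth_Cons' nth_append numeral_2_eq_2)
        have "e L = s p"
        proof (cases "ts ! 0 = p")
          case True
          have ne: "ts ! l \<noteq> p" if "0 < l" "l < k - 1" for l
            using that True ts(2) lts nth_eq_iff_index_eq[of ts l 0] by auto
          have "L = (zs ! 0) p # s p # (zs ! 0) p # replicate (k - 2) (s p)"
          proof (rule nth_equalityI)
            fix l assume "l < length L"
            then have l: "l \<le> k" using lL by simp
            consider "l = 0" | "l = 1" | "l = 2" | "l > 2" by linarith
            then show "L ! l = ((zs ! 0) p # s p # (zs ! 0) p # replicate (k - 2) (s p)) ! l"
            proof cases
              case 4
              then have "(zs ! (l - 2)) p = s p" using zs_out[of "l - 2" p] ne[of "l - 2"] l p by simp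
              then show ?thesis using 4 l Lnth[OF l] by (auto simp: nth_Cons')
            qed (use Lnth[OF l] in auto)
          qed (use lL k in simp)
          then show ?thesis using E2[OF sp zp[of 0]] k by simp
        next
          case ne0: False
          show ?thesis
          proof (cases "\<exists>l. l < k - 1 \<and> ts ! l = p")
            case True
            then obtain l where l: "l < k - 1" "ts ! l = p" by blast
            then have l0: "0 < l" using ne0 by (cases l) auto
            have ne: "ts ! l' \<noteq> p" if "l' < k - 1" "l' \<noteq> l" for l'
              using that l ts(2) lts nth_eq_iff_index_eq[of ts l' l] by auto
            show ?thesis
            proof (rule edge_op_NU_position[OF e lL, of "l + 2"])
              show "L ! (l + 2) \<in> A" using Lnth[of "l + 2"] l zp by simp
              show "L ! l' = s p" if "l' \<le> k" "l' \<noteq> l + 2" for l'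
                using Lnth[OF that(1)] zs_out[of 0 p] zs_out[of "l' - 2" p] ne0 ne[of "l' - 2"] that p k
                by auto
            qed (use l l0 sp in auto)
          next
            case False
            then have "L = s p # s p # replicate (k - 1) (s p)"
              using lL Lnth zs_out p k by (intro nth_equalityI) (auto simp: nth_Cons')
            then show ?thesis using E1[OF sp sp] by simp
          qed
        qed
        then show ?thesis using q(2)[OF pI] by (simp add: L_def)
      qed
      ultimately show ?thesis using q(1) by blast
    qed
    have us: "\<exists>u\<in>R. (\<forall>j\<in>T. u j = s j) \<and> u i = (D ^^ l) (r i)" for l
    proof (induction l)
      case 0
      then show ?case using r Suc.prems(2) by auto
    next
      case (Suc l)
      then show ?case using u_step by fastforce
    qed
    \<comment> \<open>In \<open>S\<close> the element \<open>s\<close> itself is available, so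
      \<open>e\<close> applied to \<open>s, g, s, ..., s\<close> iterates \<open>D\<close> at
      \<open>i\<close> while keeping agreement on all of \<open>P\<close>, as \<open>forks\<close>
      requires.\<close>
    have gs: "\<exists>g\<in>S. (\<forall>j\<in>P. g j = s j) \<and> g i = (D ^^ l) (r i)" for l
    proof (induction l)
      case 0
      then show ?case using r RS by auto
    next
      case (Suc l)
      then obtain g where g: "g \<in> S" "\<And>j. j \<in> P \<Longrightarrow> g j = s j" "g i = (D ^^ l) (r i)" by blast
      obtain q where q: "q \<in> S" "\<And>j. j \<in> I \<Longrightarrow> q j = e (map (\<lambda>g. g j) ([s, g] @ replicate (k - 1) s))"
        using app[of S "[s, g] @ replicate (k - 1) s"] s g(1) k by auto
      have "q j = s j" if "j \<in> P" for j
        using q(2)[of j] g(2)[OF that] that P E1[of "s j" "s j"] val[OF s, of j] by auto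
      moreover have "q i = D (g i)" using q(2)[OF P(2)] by (simp add: D_def x_def)
      ultimately show ?case using q(1) g(3) by auto
    qed
    have rA: "r i \<in> A" using r RS val P by auto
    \<comment> \<open>The value \<open>r i\<close> need not lie on a cycle of \<open>D\<close>, but
      after \<open>M\<close> steps its orbit does.\<close>
    obtain M n where n: "n \<ge> 1" and per: "(D ^^ n) ((D ^^ M) (r i)) = (D ^^ M) (r i)"
      by (rule funpow_eventually_periodic[OF finA DA rA])
    define y where "y = (D ^^ M) (r i)"
    obtain u where u: "u \<in> R" "\<And>j. j \<in> T \<Longrightarrow> u j = s j" "u i = y" using us[of M] y_def by blast
    obtain g where g: "g \<in> S" "\<forall>j\<in>P. s j = g j" "g i = y" using gs[of M] y_def by force
    obtain v w where vw: "v \<in> R" "w \<in> R" "\<And>j. j \<in> P \<Longrightarrow> v j = w j" "v i = x" "w i = y"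
      using forks[OF s g(1,2)] g(3) x_def by blast
    have yA: "y \<in> A" using u(1,3) RS val P(2) by blast

    \<comment> \<open>Leaving out \<open>ts ! 0\<close> makes room for \<open>i\<close> among the
      \<open>k - 1\<close> coordinates that \<open>projs\<close> can prescribe for
      \<open>z\<close>.\<close>
    have card_tl: "card (insert i (set (tl ts))) \<le> k - 1"
      using card_insert_le_m1[of "k - 1" "set (tl ts)" i] card_length[of "tl ts"] lts k by simp
    have tlT: "set (tl ts) \<subseteq> T" using ts(1) T'(1) k lts by (cases ts) auto
    then obtain z where z: "z \<in> R" "\<And>j. j \<in> insert i (set (tl ts)) \<Longrightarrow> z j = s j"
      using projs[OF _ _ card_tl s] P(2) TI by (metis finite_insert finite_set insert_subset subset_trans)
    have zi: "z i = x" using z(2) by (simp add: x_def)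
    \<comment> \<open>The fork is moved from \<open>v, w\<close> to \<open>z\<close>:
      \<open>e\<close> applied to \<open>v, w, z, ..., z\<close> gives \<open>z\<close> on
      \<open>P\<close> and \<open>D y\<close> at \<open>i\<close>. Further steps with
      \<open>z, w', z, ..., z\<close> iterate \<open>D\<close>, and after a full period the value at
      \<open>i\<close> is again \<open>y\<close>.\<close>
    have ws: "\<exists>w'\<in>R. (\<forall>j\<in>P. w' j = z j) \<and> w' i = (D ^^ Suc l) y" for l
    proof (induction l)
      case 0
      obtain q where q: "q \<in> R" "\<And>j. j \<in> I \<Longrightarrow> q j = e (map (\<lambda>g. g j) ([v, w] @ replicate (k - 1) z))"
        using app[of R "[v, w] @ replicate (k - 1) z"] vw(1,2) z(1) k by auto
      have "q j = z j" if "j \<in> P" for j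
        using q(2)[of j] vw(3)[OF that] E1[of "z j" "w j"] valP[OF vw(2) that] valP[OF z(1) that] by simp
      moreover have "q i = D y" using q(2)[OF P(2)] vw zi by (simp add: D_def)
      ultimately show ?case using q(1) by auto
    next
      case (Suc l)
      then obtain w' where w': "w' \<in> R" "\<And>j. j \<in> P \<Longrightarrow> w' j = z j" "w' i = (D ^^ Suc l) y" by blast
      obtain q where q: "q \<in> R" "\<And>j. j \<in> I \<Longrightarrow> q j = e (map (\<lambda>g. g j) ([z, w'] @ replicate (k - 1) z))"
        using app[of R "[z, w'] @ replicate (k - 1) z"] w'(1) z(1) k by auto
      have "q j = z j" if "j \<in> P" for j
        using q(2)[of j] w'(2)[OF that] E1[of "z j" "z j"] valP[OF z(1) that] by simp
      moreover have "q i = D (w' i)" using q(2)[OF P(2)] zi by (simp add: D_def)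
      ultimately show ?case using q(1) w'(3) by auto
    qed
    obtain w' where w': "w' \<in> R" "\<And>j. j \<in> P \<Longrightarrow> w' j = z j" "w' i = y"
      using ws[of "n - 1"] n per y_def by auto

    \<comment> \<open>At \<open>i\<close> the arguments are \<open>y, x, y, x, ..., x\<close>, so
      \<open>E2\<close> returns \<open>x = s i\<close>. On \<open>T\<close> the first two agree and
      the third is correct: either all later ones are correct too and \<open>E1\<close> applies, or
      the point lies in \<open>tl ts\<close>, where \<open>z\<close> is correct and only one
      argument can deviate.\<close>
    obtain q where q: "q \<in> R" "\<And>j. j \<in> I \<Longrightarrow> q j = e (map (\<lambda>g. g j) ([w', z, u] @ tl zs))"
    proof -
      have "set (tl zs) \<subseteq> R" using zsR by (cases zs) auto
      moreover have "length ([w', z, u] @ tl zs) = k + 1" using lzs k by simp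
      ultimately have "\<exists>q\<in>R. \<forall>j\<in>I. q j = e (map (\<lambda>g. g j) ([w', z, u] @ tl zs))"
        using w'(1) z(1) u(1) by (intro app) auto
      then show ?thesis using that by blast
    qed
    have "map (\<lambda>g. g i) (tl zs) = replicate (k - 2) x"
      using zs_i by (metis map_tl tl_replicate diff_diff_left one_add_one)
    then have "q i = s i"
      using q(2)[OF P(2)] w'(3) zi u(3) E2[OF x yA] by (simp add: x_def)
    moreover have "q p = s p" if p: "p \<in> T" for p
    proof -
      have pI: "p \<in> I" and pP: "p \<in> P" and sp: "s p \<in> A" using p TI val s Suc.prems by auto
      have zA: "z p \<in> A" using z(1) RS val pI by blast
      have zp: "(zs ! l) p \<in> A" if "l < k - 1" for l
        using that zsR lzs RS val pI by (metis nth_mem subsetD)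
      define L where "L = map (\<lambda>g. g p) ([w', z, u] @ tl zs)"
      have lL: "length L = k + 1" using lzs k by (simp add: L_def)
      have Lnth: "L ! l = (if l \<le> 1 then z p else if l = 2 then s p else (zs ! (l - 2)) p)"
        if "l \<le> k" for l
        using that lzs u(2)[OF p] w'(2)[OF pP] k
        by (auto simp: L_def nth_Cons' nth_append nth_tl numeral_2_eq_2 Suc_diff_Suc numeral_3_eq_3)
      have "e L = s p"
      proof (cases "\<exists>l. 0 < l \<and> l < k - 1 \<and> ts ! l = p")
        case True
        then obtain l where l: "0 < l" "l < k - 1" "ts ! l = p" by blast
        then have "p \<in> set (tl ts)" using lts by (cases ts) (auto simp: nth_Cons')
        then have zs: "z p = s p" using z(2) by blast
        have ne: "ts ! l' \<noteq> p" if "l' < k - 1" "l' \<noteq> l" for l'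
          using that l ts(2) lts nth_eq_iff_index_eq[of ts l' l] by auto
        show ?thesis
        proof (rule edge_op_NU_position[OF e lL, of "l + 2"])
          show "L ! (l + 2) \<in> A" using Lnth[of "l + 2"] l zp by simp
          show "L ! l' = s p" if "l' \<le> k" "l' \<noteq> l + 2" for l'
            using Lnth[OF that(1)] zs zs_out[of "l' - 2" p] ne[of "l' - 2"] that p k by auto
        qed (use l sp in auto)
      next
        case False
        have "(zs ! (l - 2)) p = s p" if "2 < l" "l \<le> k" for l
        proof -
          have "0 < l - 2" "l - 2 < k - 1" using that k by auto
          then show ?thesis using zs_out[of "l - 2" p] p False by blast
        qed
        then have "L = z p # z p # replicate (k - 1) (s p)"
          using lL Lnth k by (intro nth_equalityI) (auto simp: nth_Cons')
        then show ?thesis using E1[OF sp zA] by simp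
      qed
      then show ?thesis using q(2)[OF pI] by (simp add: L_def)
    qed
    ultimately show ?thesis using q(1) by blast
  qed
qed

text \<open>Agreement with a given \<open>s\<close> is extended one coordinate at a time in the
  order of \<open>rank\<close>. Injectivity ensures that each step adds at most one coordinate, and
  finiteness of \<open>I\<close> lets \<open>edge_extend_agreement\<close> be used with
  \<open>T\<close> equal to the whole prefix \<open>P\<close>.\<close>

lemma edge_subpower_eq:
  fixes I :: "'i set" and rank :: "'i \<Rightarrow> nat"
  assumes k: "k > 1" and e: "is_edge_op A k e" and finA: "finite A"
    and finI: "finite I" and inj: "inj_on rank I"
    and RS: "R \<subseteq> S" and SA: "S \<subseteq> rtuples I A"
    and closR: "preserves e (k + 1) I R" and closS: "preserves e (k + 1) I S"
    and projs: "\<And>T s. T \<subseteq> I \<Longrightarrow> finite T \<Longrightarrow> card T \<le> k - 1 \<Longrightarrow> s \<in> S \<Longrightarrow> \<exists>r\<in>R. \<forall>j\<in>T. r j = s j"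
    and forks: "\<And>i f g. i \<in> I \<Longrightarrow> f \<in> S \<Longrightarrow> g \<in> S \<Longrightarrow>
      \<forall>j\<in>{j \<in> I. rank j < rank i}. f j = g j \<Longrightarrow>
      \<exists>f'\<in>R. \<exists>g'\<in>R. (\<forall>j\<in>{j \<in> I. rank j < rank i}. f' j = g' j) \<and> f' i = f i \<and> g' i = g i"
  shows "R = S"
proof
  show "S \<subseteq> R"
  proof
    fix s assume s: "s \<in> S"
    have prefix: "\<exists>r\<in>R. \<forall>j\<in>{j \<in> I. rank j < n}. r j = s j" for n
    proof (induction n)
      case 0
      then show ?case using projs[of "{}" s] s by auto
    next
      case (Suc n)
      then obtain r where r: "r \<in> R" "\<And>j. j \<in> {j \<in> I. rank j < n} \<Longrightarrow> r j = s j" by blast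
      show ?case
      proof (cases "\<exists>i\<in>I. rank i = n")
        case True
        then obtain i where i: "i \<in> I" "rank i = n" by blast
        have "{j \<in> I. rank j < Suc n} = insert i {j \<in> I. rank j < n}"
          using i inj by (auto simp: less_Suc_eq inj_on_def)
        moreover have "\<exists>q\<in>R. \<forall>j\<in>insert i {j \<in> I. rank j < n}. q j = s j"
        proof (rule edge_extend_agreement[OF k e finA RS SA closR closS projs _ i(1) _ s r])
          fix f g assume "f \<in> S" "g \<in> S" "\<forall>j\<in>{j \<in> I. rank j < n}. f j = g j"
          then show "\<exists>f'\<in>R. \<exists>g'\<in>R. (\<forall>j\<in>{j \<in> I. rank j < n}. f' j = g' j) \<and> f' i = f i \<and> g' i = g i"
            using forks[OF i(1), of f g] i(2) by simp
        qed (use finI in auto)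
        ultimately show ?thesis by simp
      next
        case False
        then have "{j \<in> I. rank j < Suc n} = {j \<in> I. rank j < n}" by (auto simp: less_Suc_eq)
        then show ?thesis using r by auto
      qed
    qed
    obtain N where N: "\<forall>j\<in>I. rank j < N"
      using finI finite_nat_set_iff_bounded[of "rank ` I"] by auto
    then obtain r where r: "r \<in> R" "\<forall>j\<in>I. r j = s j" using prefix[of N] by blast
    have "r \<in> rtuples I A" "s \<in> rtuples I A" using r(1) RS s SA by blast+
    then have "r = s" using r(2) by (fastforce simp: rtuples_def)
    then show "s \<in> R" using r(1) by simp
  qed
qed (fact RS)

subsection \<open>Comparing the two clones\<close>

lemma lex_less_iff_nth:
  "lex_less c a \<longleftrightarrow> length c = length a \<and> (\<exists>i<length a. (\<forall>l<i. c ! l = a ! l) \<and> c ! i < a ! i)"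
proof -
  have "take i c = take i a \<longleftrightarrow> (\<forall>l<i. c ! l = a ! l)" if "length c = length a" "i < length a" for i
    using that by (auto simp: list_eq_iff_nth_eq)
  then show ?thesis unfolding lex_less_def by blast
qed

lemma lex_less_irrefl: "\<not> lex_less a a"
  by (simp add: lex_less_iff_nth)

lemma lex_less_trans:
  assumes "lex_less a b" "lex_less b c"
  shows "lex_less a c"
proof -
  obtain i where i: "i < length b" "\<And>l. l < i \<Longrightarrow> a ! l = b ! l" "a ! i < b ! i"
    using assms(1) unfolding lex_less_iff_nth by blast
  obtain j where j: "j < length c" "\<And>l. l < j \<Longrightarrow> b ! l = c ! l" "b ! j < c ! j"
    using assms(2) unfolding lex_less_iff_nth by blast
  have len: "length a = length b" "length b = length c"
    using assms unfolding lex_less_iff_nth by auto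
  have "a ! min i j < c ! min i j"
    by (rule linorder_cases[of i j]) (use i j in \<open>auto simp: min_def\<close>)
  moreover have "\<forall>l<min i j. a ! l = c ! l" using i j by simp
  ultimately show ?thesis
    unfolding lex_less_iff_nth using len i(1) by (auto intro!: exI[of _ "min i j"])
qed

lemma lex_less_total:
  assumes "length a = length b" "a \<noteq> b"
  shows "lex_less a b \<or> lex_less b a"
proof -
  let ?P = "\<lambda>i. i < length a \<and> a ! i \<noteq> b ! i"
  have "\<exists>i. ?P i" using assms by (auto simp: list_eq_iff_nth_eq)
  then have L: "?P (LEAST i. ?P i)" by (rule LeastI_ex)
  have eq: "a ! l = b ! l" if "l < (LEAST i. ?P i)" for l
    using not_less_Least[OF that] that L by simp
  obtain i where i: "i < length a" "a ! i \<noteq> b ! i" "\<And>l. l < i \<Longrightarrow> a ! l = b ! l"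
    using L eq that by blast
  then consider "a ! i < b ! i" | "b ! i < a ! i" by linarith
  then show ?thesis unfolding lex_less_iff_nth using assms(1) i by cases auto
qed

lemma finite_tup: "finite A \<Longrightarrow> finite (tup A n)"
  using finite_lists_length_eq[of A n] by (simp add: tup_def conj_commute)

text \<open>The number of lexicographic predecessors is an order isomorphism onto an initial segment
  of the naturals; it provides the numerical ranking of coordinates used for subpowers.\<close>

lemma lex_less_rank:
  assumes "finite A"
  obtains rank where "inj_on rank (tup A n)"
    and "\<And>a b. a \<in> tup A n \<Longrightarrow> b \<in> tup A n \<Longrightarrow> rank a < (rank b :: nat) \<longleftrightarrow> lex_less a b"
proof -
  define rank where "rank b = card {c \<in> tup A n. lex_less c b}" for b
  have mono: "rank a < rank b" if "a \<in> tup A n" "lex_less a b" for a b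
    unfolding rank_def
  proof (rule psubset_card_mono)
    show "{c \<in> tup A n. lex_less c a} \<subset> {c \<in> tup A n. lex_less c b}"
      using that lex_less_trans lex_less_irrefl by blast
  qed (use finite_tup[OF assms] in auto)
  have iff: "rank a < rank b \<longleftrightarrow> lex_less a b" if "a \<in> tup A n" "b \<in> tup A n" for a b
  proof
    assume less: "rank a < rank b"
    then have "a \<noteq> b" "\<not> lex_less b a" using mono[OF that(2)] by fastforce+
    then show "lex_less a b" using lex_less_total[of a b] that by (auto simp: tup_def)
  qed (use mono that in blast)
  have "inj_on rank (tup A n)"
  proof (rule inj_onI, rule ccontr)
    fix a b assume "a \<in> tup A n" "b \<in> tup A n" "rank a = rank b" "a \<noteq> b"
    then show False using lex_less_total[of a b] iff[of a b] iff[of b a] by (auto simp: tup_def)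
  qed
  then show ?thesis using that iff by blast
qed

section \<open>Clones of operations preserving relations\<close>

lemma preservesD:
  assumes "preserves f r I R" "length gs = r" "set gs \<subseteq> R"
  shows "(\<lambda>i. if i \<in> I then f (map (\<lambda>g. g i) gs) else undefined) \<in> R"
  using assms unfolding preserves_def by blast

lemma preserves_proj:
  assumes "j < n" and "R \<subseteq> rtuples I A"
  shows "preserves (proj A n j) n I R"
  unfolding preserves_def
proof (intro allI impI)
  fix gs assume gs: "length gs = n" "set gs \<subseteq> R"
  have mem: "g i \<in> A" if "g \<in> set gs" "i \<in> I" for g i
    using that gs assms(2) by (auto simp: rtuples_def)
  have gj: "gs ! j \<in> R" using gs assms(1) by auto
  have "(\<lambda>i. if i \<in> I then proj A n j (map (\<lambda>g. g i) gs) else undefined) = gs ! j"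
  proof
    fix i
    show "(if i \<in> I then proj A n j (map (\<lambda>g. g i) gs) else undefined) = (gs ! j) i"
    proof (cases "i \<in> I")
      case True
      then have "map (\<lambda>g. g i) gs \<in> tup A n" using mem gs(1) by (auto simp: tup_def)
      then show ?thesis using True assms(1) gs(1) by (simp add: proj_def)
    next
      case False
      then show ?thesis using gj assms(2) by (auto simp: rtuples_def)
    qed
  qed
  then show "(\<lambda>i. if i \<in> I then proj A n j (map (\<lambda>g. g i) gs) else undefined) \<in> R"
    using gj by simp
qed

lemma preserves_comp:
  assumes f: "preserves f r I R" and len: "length gs = r"
    and gs: "\<And>g. g \<in> set gs \<Longrightarrow> preserves g n I R" and R: "R \<subseteq> rtuples I A"
  shows "preserves (comp A n f gs) n I R"
  unfolding preserves_def
proof (intro allI impI)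
  fix hs assume hs: "length hs = n" "set hs \<subseteq> R"
  let ?gs = "map (\<lambda>g i. if i \<in> I then g (map (\<lambda>h. h i) hs) else undefined) gs"
  have "set ?gs \<subseteq> R" using gs hs unfolding preserves_def by auto
  then have "(\<lambda>i. if i \<in> I then f (map (\<lambda>g. g i) ?gs) else undefined) \<in> R"
    using len by (intro preservesD[OF f]) simp
  moreover have "map (\<lambda>h. h i) hs \<in> tup A n" if "i \<in> I" for i
    using that hs R by (auto simp: tup_def rtuples_def)
  then have "(\<lambda>i. if i \<in> I then f (map (\<lambda>g. g i) ?gs) else undefined) =
      (\<lambda>i. if i \<in> I then comp A n f gs (map (\<lambda>h. h i) hs) else undefined)"
    by (auto simp: comp_def o_def)
  ultimately show "(\<lambda>i. if i \<in> I then comp A n f gs (map (\<lambda>h. h i) hs) else undefined) \<in> R"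
    by simp
qed

text \<open>For \<open>p = k - 1\<close> this is the right-hand side of the theorem. Arity 0 is
  empty because \<open>is_clone\<close> demands it.\<close>

definition bounded_pol :: "nat set \<Rightarrow> (nat \<Rightarrow> (nat list \<Rightarrow> nat) set) \<Rightarrow> nat \<Rightarrow> nat \<Rightarrow>
    nat \<Rightarrow> (nat list \<Rightarrow> nat) set" where
  "bounded_pol A C m p n = (if n = 0 then {} else
     {f \<in> ops A n. preserves f n (tup A m) (C m) \<and>
       (\<forall>B. subuniverse_pow A C p B \<longrightarrow> preserves f n {0..<p} B)})"

lemma ops_eq_rtuples: "ops A n = rtuples (tup A n) A"
  by (simp add: ops_def rtuples_def)

lemma clone_subset_rtuples:
  assumes "is_clone A C" "1 \<le> n"
  shows "C n \<subseteq> rtuples (tup A n) A"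
  using assms by (simp add: is_clone_def ops_eq_rtuples)

text \<open>For members of \<open>C n\<close> read as tuples indexed by \<open>tup A n\<close>,
  coordinatewise application is composition.\<close>

lemma clone_preserves_clone:
  assumes "is_clone A C" "f \<in> C r" "1 \<le> n"
  shows "preserves f r (tup A n) (C n)"
proof -
  have "1 \<le> r" using assms unfolding is_clone_def by (cases r) auto
  then show ?thesis using assms unfolding is_clone_def preserves_def comp_def by auto
qed

lemma is_clone_bounded_pol:
  assumes C: "is_clone A C" and m: "1 \<le> m"
  shows "is_clone A (bounded_pol A C m p)"
proof -
  have Cm: "C m \<subseteq> rtuples (tup A m) A" using clone_subset_rtuples[OF C m] .
  have B: "B \<subseteq> rtuples {0..<p} A" if "subuniverse_pow A C p B" for B
    using that by (simp add: subuniverse_pow_def)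
  show ?thesis
    unfolding is_clone_def
  proof (intro conjI allI impI)
    show "bounded_pol A C m p 0 = {}" by (simp add: bounded_pol_def)
    show "bounded_pol A C m p n \<subseteq> ops A n" if "1 \<le> n" for n
      using that by (auto simp: bounded_pol_def)
  next
    fix n i :: nat assume n: "1 \<le> n" "i < n"
    have "proj A n i \<in> ops A n" using n by (auto simp: proj_def ops_def tup_def)
    then show "proj A n i \<in> bounded_pol A C m p n"
      using n B Cm by (auto simp: bounded_pol_def intro!: preserves_proj)
  next
    fix r n f gs assume rn: "1 \<le> r" "1 \<le> n" and f: "f \<in> bounded_pol A C m p r"
      and len: "length gs = r" and gs: "set gs \<subseteq> bounded_pol A C m p n"
    have "comp A n f gs \<in> ops A n"
    proof -
      have "map (\<lambda>g. g x) gs \<in> tup A r" if "x \<in> tup A n" for x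
        using that gs len rn by (auto simp: bounded_pol_def ops_def tup_def)
      then show ?thesis using f rn by (auto simp: bounded_pol_def ops_def comp_def)
    qed
    moreover have "preserves (comp A n f gs) n (tup A m) (C m)"
      using f gs rn len Cm by (intro preserves_comp[of f r]) (auto simp: bounded_pol_def)
    moreover have "preserves (comp A n f gs) n {0..<p} B" if "subuniverse_pow A C p B" for B
      using f gs rn len B[OF that] that by (intro preserves_comp[of f r]) (auto simp: bounded_pol_def)
    ultimately show "comp A n f gs \<in> bounded_pol A C m p n" using rn by (simp add: bounded_pol_def)
  qed
qed

lemma clone_subset_bounded_pol:
  assumes C: "is_clone A C" and m: "1 \<le> m"
  shows "C n \<subseteq> bounded_pol A C m p n"
proof
  fix f assume f: "f \<in> C n"
  then have "1 \<le> n" using C unfolding is_clone_def by (cases n) auto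
  then show "f \<in> bounded_pol A C m p n"
    using f C clone_preserves_clone[OF C f m]
    by (auto simp: bounded_pol_def is_clone_def subuniverse_pow_def)
qed

section \<open>Comparison of a clone with the operations preserving its small relations\<close>

lemma map_nth_upt_tup: "x \<in> tup A n \<Longrightarrow> map ((!) x) [0..<n] = x"
  by (auto simp: tup_def map_nth)

text \<open>In arity \<open>m\<close>, applying an operation that preserves \<open>C m\<close> to
  the projections returns the operation itself. Smaller arities are reduced to this by adding dummy
  variables and identifying them away again.\<close>

lemma bounded_pol_subset_clone:
  assumes C: "is_clone A C" and n: "1 \<le> n" "n \<le> m"
  shows "bounded_pol A C m p n \<subseteq> C n"
proof
  let ?D = "bounded_pol A C m p"
  fix f assume f: "f \<in> ?D n"
  have m: "1 \<le> m" using n by simp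
  have D: "is_clone A ?D" using is_clone_bounded_pol[OF C m] .
  have top: "g \<in> C m" if g: "g \<in> ?D m" for g
  proof -
    have pres: "preserves g m (tup A m) (C m)" and gops: "g \<in> ops A m"
      using g m by (auto simp: bounded_pol_def)
    have "set (map (proj A m) [0..<m]) \<subseteq> C m" using C m unfolding is_clone_def by auto
    then have "(\<lambda>x. if x \<in> tup A m then g (map (\<lambda>h. h x) (map (proj A m) [0..<m])) else undefined) \<in> C m"
      by (intro preservesD[OF pres]) simp
    moreover have "(\<lambda>x. if x \<in> tup A m then g (map (\<lambda>h. h x) (map (proj A m) [0..<m])) else undefined) = g"
    proof
      fix x
      show "(if x \<in> tup A m then g (map (\<lambda>h. h x) (map (proj A m) [0..<m])) else undefined) = g x"
        using gops map_nth_upt_tup[of x A m] by (auto simp: ops_def proj_def o_def)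
    qed
    ultimately show ?thesis by simp
  qed
  obtain g where g: "g \<in> ?D m" "\<And>x. x \<in> tup A m \<Longrightarrow> g x = f (map (\<lambda>j. x ! j) [0..<n])"
    using clone_substitution[OF D f m, of "\<lambda>j. j"] n by auto
  \<comment> \<open>The dummy variables are identified with variable \<open>0\<close>, which exists
    since \<open>n\<close> is at least 1.\<close>
  have lt: "(if j < n then j else 0) < n" for j using n(1) by simp
  obtain h where h: "h \<in> C n"
    "\<And>x. x \<in> tup A n \<Longrightarrow> h x = g (map (\<lambda>j. x ! (if j < n then j else 0)) [0..<m])"
  proof (rule clone_substitution[where \<sigma> = "\<lambda>j. if j < n then j else 0", OF C top[OF g(1)] n(1) lt])
  qed (rule that)
  have "h = f"
  proof
    fix x
    show "h x = f x"
    proof (cases "x \<in> tup A n")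
      case True
      let ?y = "map (\<lambda>j. x ! (if j < n then j else 0)) [0..<m]"
      have "x ! (if j < n then j else 0) \<in> A" for j
        using True lt[of j] nth_mem[of "if j < n then j else 0" x] unfolding tup_def by blast
      then have "?y \<in> tup A m" by (auto simp: tup_def)
      then have "h x = f (map (\<lambda>j. ?y ! j) [0..<n])" using h(2)[OF True] g(2) by simp
      moreover have "map (\<lambda>j. ?y ! j) [0..<n] = x"
        using True n by (intro nth_equalityI) (auto simp: tup_def)
      ultimately show ?thesis by simp
    next
      case False
      moreover have "h \<in> ops A n" using h(1) clone_subset_rtuples[OF C n(1)] by (auto simp: ops_eq_rtuples)
      moreover have "f \<in> ops A n" using f n(1) by (simp add: bounded_pol_def)
      ultimately show ?thesis by (simp add: ops_def)
    qed
  qed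
  then show "f \<in> C n" using h(1) by simp
qed

text \<open>The restrictions to \<open>T\<close> of the members of \<open>C n\<close> form a
  subuniverse of the \<open>p\<close>-th power that contains the restricted projections. Since
  \<open>s\<close> preserves it, the restriction of \<open>s\<close> belongs to it.\<close>

lemma bounded_pol_agrees_on_small_sets:
  assumes C: "is_clone A C" and n: "1 \<le> n" and s: "s \<in> bounded_pol A C m p n"
    and T: "T \<subseteq> tup A n" "finite T" "card T \<le> p"
  shows "\<exists>r\<in>C n. \<forall>x\<in>T. r x = s x"
proof (cases "T = {}")
  case True
  moreover have "proj A n 0 \<in> C n" using C n unfolding is_clone_def by simp
  ultimately show ?thesis by blast
next
  case False
  obtain ts where ts: "set ts = T" "distinct ts" using finite_distinct_list[OF T(2)] by blast
  then have lts: "length ts \<le> p" "ts \<noteq> []" using T(3) distinct_card[of ts] False by auto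
  \<comment> \<open>If \<open>T\<close> has fewer than \<open>p\<close> points, its first listed
    point is repeated to fill \<open>p\<close> coordinates; this is why the empty set is treated
    apart.\<close>
  define at where "at i = (if i < length ts then ts ! i else ts ! 0)" for i
  have at: "at i \<in> T" for i using ts lts by (auto simp: at_def)
  define tupl where "tupl f = (\<lambda>i. if i \<in> {0..<p} then f (at i) else undefined)" for f :: "nat list \<Rightarrow> nat"
  let ?B = "tupl ` C n"
  have "subuniverse_pow A C p ?B"
    unfolding subuniverse_pow_def
  proof (intro conjI allI impI ballI)
    show "?B \<subseteq> rtuples {0..<p} A"
      using C n at T(1) by (fastforce simp: tupl_def rtuples_def is_clone_def ops_def)
  next
    fix r f assume r: "(1::nat) \<le> r" and f: "f \<in> C r"
    show "preserves f r {0..<p} ?B"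
      unfolding preserves_def
    proof (intro allI impI)
      fix bs assume bs: "length bs = r" "set bs \<subseteq> ?B"
      define gs where "gs = map (inv_into (C n) tupl) bs"
      have gs: "bs = map tupl gs" "set gs \<subseteq> C n"
        using bs(2) by (auto simp: gs_def o_def f_inv_into_f subset_iff inv_into_into intro!: map_idI[symmetric])
      have "comp A n f gs \<in> C n" using C r n f gs bs unfolding is_clone_def by auto
      moreover have "(\<lambda>i. if i \<in> {0..<p} then f (map (\<lambda>g. g i) bs) else undefined) = tupl (comp A n f gs)"
        using at T(1) by (fastforce simp: tupl_def comp_def gs(1) o_def)
      ultimately show "(\<lambda>i. if i \<in> {0..<p} then f (map (\<lambda>g. g i) bs) else undefined) \<in> ?B" by blast
    qed
  qed
  then have pres: "preserves s n {0..<p} ?B" using s n by (auto simp: bounded_pol_def)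
  have "set (map (\<lambda>j. tupl (proj A n j)) [0..<n]) \<subseteq> ?B"
    using C n unfolding is_clone_def by auto
  then have "(\<lambda>i. if i \<in> {0..<p} then s (map (\<lambda>g. g i) (map (\<lambda>j. tupl (proj A n j)) [0..<n])) else undefined) \<in> ?B"
    by (intro preservesD[OF pres]) simp
  then obtain r where r: "r \<in> C n"
    "tupl r = (\<lambda>i. if i \<in> {0..<p} then s (map (\<lambda>g. g i) (map (\<lambda>j. tupl (proj A n j)) [0..<n])) else undefined)"
    by (elim imageE) simp
  have "r x = s x" if "x \<in> T" for x
  proof -
    obtain i where i: "i < length ts" "ts ! i = x" using \<open>x \<in> T\<close> ts(1) by (auto simp: in_set_conv_nth)
    have xt: "x \<in> tup A n" using that T(1) by blast
    have ip: "i < p" and ai: "at i = x" using i lts by (auto simp: at_def)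
    have "r x = s (map (\<lambda>j. x ! j) [0..<n])"
      using fun_cong[OF r(2), of i] ip ai xt by (simp add: tupl_def proj_def o_def)
    then show ?thesis using map_nth_upt_tup[OF xt] by simp
  qed
  then show ?thesis using r(1) by blast
qed

text \<open>Induction on the length shows that words in \<open>lam\<close> for \<open>C\<close> are
  in \<open>lam\<close> for the larger clone. A minimal word has length at most \<open>m\<close>,
  where the larger clone adds nothing; any other lies above a shorter word of \<open>lam\<close>,
  and upward closedness for the larger clone applies.\<close>

lemma phi_bounded_pol:
  assumes C: "is_clone A C" and m: "1 \<le> m"
    and minl: "\<And>a. minimal_E (lam A C cd) a \<Longrightarrow> length a \<le> m"
    and a: "a \<noteq> []" "set a \<subseteq> A" and cd: "cd \<in> phi A (bounded_pol A C m p) a"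
  shows "cd \<in> phi A C a"
proof -
  let ?D = "bounded_pol A C m p"
  have D: "is_clone A ?D" using is_clone_bounded_pol[OF C m] .
  have "a \<in> lam A C cd \<Longrightarrow> cd \<notin> phi A ?D a" for a
  proof (induction "length a" arbitrary: a rule: less_induct)
    case (less a)
    have a: "a \<noteq> []" "set a \<subseteq> A" "cd \<notin> phi A C a" using less.prems by (auto simp: lam_def)
    show ?case
    proof (cases "minimal_E (lam A C cd) a")
      case True
      then have "?D (length a) \<subseteq> C (length a)"
        using bounded_pol_subset_clone[OF C _ minl[OF True]] a(1) by (cases a) auto
      then have "phi A ?D a \<subseteq> phi A C a" unfolding phi_def by blast
      then show ?thesis using a(3) by blast
    next
      case False
      then obtain b where b: "b \<in> lam A C cd" "le_E b a" "b \<noteq> a"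
        using less.prems unfolding minimal_E_def by blast
      then have "cd \<notin> phi A ?D b" using less.hyps[of b] le_E_length[of b a] by blast
      then show ?thesis using phi_antimono[OF D b(2), of cd] b(1) unfolding lam_def by blast
    qed
  qed
  then show ?thesis using a cd by (auto simp: lam_def)
qed

text \<open>Both \<open>n\<close>-ary parts are subpowers with coordinates \<open>tup A n\<close>.
  Ordered lexicographically, their forks at \<open>a\<close> are the pairs in \<open>phi\<close> at
  \<open>a\<close>, so \<open>edge_subpower_eq\<close> applies.\<close>

lemma clone_eq_bounded_pol:
  assumes finA: "finite A" and k: "k > 1" and C: "is_clone A C"
    and e: "e \<in> C (k + 1)" "is_edge_op A k e" and m: "1 \<le> m" and n: "1 \<le> n"
    and minl: "\<And>c d a. c \<in> A \<Longrightarrow> d \<in> A \<Longrightarrow> minimal_E (lam A C (c, d)) a \<Longrightarrow> length a \<le> m"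
  shows "C n = bounded_pol A C m (k - 1) n"
proof -
  let ?D = "bounded_pol A C m (k - 1)"
  have D: "is_clone A ?D" using is_clone_bounded_pol[OF C m] .
  obtain rank :: "nat list \<Rightarrow> nat" where inj: "inj_on rank (tup A n)"
    and rank: "\<And>a b. a \<in> tup A n \<Longrightarrow> b \<in> tup A n \<Longrightarrow> rank a < rank b \<longleftrightarrow> lex_less a b"
    by (rule lex_less_rank[OF finA, of n]) (rule that)
  have CD: "C i \<subseteq> ?D i" for i using clone_subset_bounded_pol[OF C m] .
  show ?thesis
  proof (rule edge_subpower_eq[OF k e(2) finA finite_tup[OF finA] inj CD])
    show "?D n \<subseteq> rtuples (tup A n) A" using clone_subset_rtuples[OF D n] .
    show "preserves e (k + 1) (tup A n) (C n)" using clone_preserves_clone[OF C e(1) n] .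
    show "preserves e (k + 1) (tup A n) (?D n)" using clone_preserves_clone[OF D _ n] e(1) CD by blast
    show "\<exists>r\<in>C n. \<forall>j\<in>T. r j = s j"
      if "T \<subseteq> tup A n" "finite T" "card T \<le> k - 1" "s \<in> ?D n" for T s
      using bounded_pol_agrees_on_small_sets[OF C n that(4,1,2,3)] .
  next
    fix a f g
    assume a: "a \<in> tup A n" and f: "f \<in> ?D n" and g: "g \<in> ?D n"
      and eq: "\<forall>j\<in>{j \<in> tup A n. rank j < rank a}. f j = g j"
    have len: "length a = n" "a \<noteq> []" "set a \<subseteq> A" using a n by (auto simp: tup_def)
    have "(f a, g a) \<in> phi A ?D a"
      unfolding phi_def using f g eq rank[OF _ a] len(1) by auto
    \<comment> \<open>The bound on minimal words is available only for pairs over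
      \<open>A\<close>.\<close>
    moreover have "f a \<in> A" "g a \<in> A"
      using a f g n D by (auto simp: is_clone_def ops_def)
    ultimately have "(f a, g a) \<in> phi A C a"
      using phi_bounded_pol[OF C m _ len(2,3)] minl by blast
    then obtain f' g' where "f' \<in> C n" "g' \<in> C n" "f' a = f a" "g' a = g a"
      "\<And>c. c \<in> tup A n \<Longrightarrow> lex_less c a \<Longrightarrow> f' c = g' c"
      unfolding phi_def len(1) by auto
    then show "\<exists>f'\<in>C n. \<exists>g'\<in>C n. (\<forall>j\<in>{j \<in> tup A n. rank j < rank a}. f' j = g' j) \<and>
        f' a = f a \<and> g' a = g a"
      using rank[OF _ a] by (intro bexI[of _ f'] bexI[of _ g']) auto
  qed
qed

theorem theorem6p1:
  fixes t k :: nat and C :: "nat \<Rightarrow> (nat list \<Rightarrow> nat) set"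
  assumes "t \<ge> 1" and "k > 1"
    and "is_clone {1..t} C"
    and "\<exists>e\<in>C (k+1). is_edge_op {1..t} k e"
  defines "L \<equiv> {length a | a c d. c \<in> {1..t} \<and> d \<in> {1..t} \<and> minimal_E (lam {1..t} C (c, d)) a}"
  shows "finite L \<and>
    (let m = (if L = {} then 1 else Max L) in
      \<forall>n\<ge>1. C n = {f \<in> ops {1..t} n.
                    preserves f n (tup {1..t} m) (C m) \<and>
                    (\<forall>B. subuniverse_pow {1..t} C (k - 1) B \<longrightarrow> preserves f n {0..<k-1} B)})"
proof -
  define A where "A = {1..t}"
  have finA: "finite A" and C: "is_clone A C" using assms(3) by (simp_all add: A_def)
  \<comment> \<open>Distinct minimal words are incomparable, so they form an antichain.\<close>
  have "finite {a. minimal_E (lam A C cd) a}" for cd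
    by (rule finite_le_E_antichain[OF finA]) (auto simp: minimal_E_def lam_def)
  then have "finite (\<Union>c\<in>A. \<Union>d\<in>A. length ` {a. minimal_E (lam A C (c, d)) a})" using finA by blast
  moreover have L: "L = (\<Union>c\<in>A. \<Union>d\<in>A. length ` {a. minimal_E (lam A C (c, d)) a})"
    unfolding L_def A_def by blast
  ultimately have finL: "finite L" by simp
  define m where "m = (if L = {} then 1 else Max L)"
  \<comment> \<open>Words in \<open>lam\<close> are nonempty; together with the default 1 for empty
    \<open>L\<close> this gives \<open>1 \<le> m\<close>.\<close>
  have L_pos: "l \<ge> 1" if "l \<in> L" for l
    using that unfolding L minimal_E_def lam_def by (auto simp: Suc_le_eq)
  have m: "1 \<le> m" using L_pos finL by (simp add: m_def)
  have minl: "length a \<le> m" if "c \<in> A" "d \<in> A" "minimal_E (lam A C (c, d)) a" for a c d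
  proof -
    have "length a \<in> L" using that unfolding L by blast
    then show ?thesis using finL by (auto simp: m_def)
  qed
  obtain e where e: "e \<in> C (k + 1)" "is_edge_op A k e" using assms(4) by (auto simp: A_def)
  have "C n = bounded_pol A C m (k - 1) n" if "1 \<le> n" for n
    by (rule clone_eq_bounded_pol[OF finA assms(2) C e m that minl])
  then have "\<forall>n\<ge>1. C n = {f \<in> ops A n. preserves f n (tup A m) (C m) \<and>
      (\<forall>B. subuniverse_pow A C (k - 1) B \<longrightarrow> preserves f n {0..<k-1} B)}"
    by (simp add: bounded_pol_def)
  with finL show ?thesis unfolding Let_def m_def[symmetric] A_def[symmetric] by (rule conjI)
qed

end
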